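(* Let $R$ be a ring with involution $*$, let $a\in R$ be pseudo core invertible, let $b\in R$ and $f=a+b$. If $f$ is pseudo core invertible, then the following statements are equivalent: (1) $a^{(D)}(a+f)f^{(D)}=a^{(D)}+f^{(D)}$; (2) $1+a^{(D)}b$ is invertible and $f^{(D)}=(1+a^{(D)}b)^{-1}a^{(D)}$; (3) $1+a^Db$ is invertible and $(1+a^Db)^{-1}a^D\in T_l(f)$; (4) $1+a^{(D)}b$ is invertible and $(1+a^{(D)}b)^{-1}x\in T_l(f)$ for arbitrary $x\in T_l(a)$.
   Context: Rings are associative with identity $1$; an involution is an additive map $*$ on $R$ with $(xy)^*=y^*x^*$ and $(x^* )^*=x$. An element $a\in R$ is Drazin invertible if there are $x\in R$ and a positive integer $k$ with $xa^{k+1}=a^k$, $ax^2=x$, $xa=ax$; then $x$ is unique, is called the Drazin inverse of $a$ and is denoted $a^D$. An element $a\in R$ is pseudo core invertible if there are $x\in R$ and a positive integer $k$ with $xa^{k+1}=a^k$, $ax^2=x$, $(ax)^*=ax$; then $x$ is unique, is called the pseudo core inverse of $a$ and is denoted $a^{(D)}$. Every pseudo core invertible element is Drazin invertible. For a Drazin invertible $a$, $T_l(a)=\{x\in R:\ xa^{k+1}=a^k \text{ for some positive integer } k,\ ax^2=x\}$ (the elements of $T_l(a)$ are called the minimal weak Drazin inverses of $a$). *)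

theory Defs
  imports Main
begin

text \<open>
  The sort \<open>{ring, monoid_mult}\<close> is used instead of \<^class>\<open>ring_1\<close> because the latter
  includes the axiom \<open>0 \<noteq> 1\<close>, which is not part of the definition of a ring with identity here.
\<close>

definition involution :: "('a::{ring,monoid_mult} \<Rightarrow> 'a) \<Rightarrow> bool" where
  "involution star \<longleftrightarrow>
     (\<forall>x y. star (x + y) = star x + star y) \<and>
     (\<forall>x y. star (x * y) = star y * star x) \<and>
     (\<forall>x. star (star x) = x)"

definition is_two_sided_inverse :: "'a::{ring,monoid_mult} \<Rightarrow> 'a \<Rightarrow> bool" where
  "is_two_sided_inverse a x \<longleftrightarrow> a * x = 1 \<and> x * a = 1"

definition ring_invertible :: "'a::{ring,monoid_mult} \<Rightarrow> bool" where
  "ring_invertible a \<longleftrightarrow> (\<exists>x. is_two_sided_inverse a x)"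

definition ring_inverse :: "'a::{ring,monoid_mult} \<Rightarrow> 'a" where
  "ring_inverse a = (THE x. is_two_sided_inverse a x)"

definition is_drazin_inverse :: "'a::{ring,monoid_mult} \<Rightarrow> 'a \<Rightarrow> bool" where
  "is_drazin_inverse a x \<longleftrightarrow>
     (\<exists>k::nat. k > 0 \<and> x * a ^ (k + 1) = a ^ k) \<and> a * x\<^sup>2 = x \<and> x * a = a * x"

definition drazin_invertible :: "'a::{ring,monoid_mult} \<Rightarrow> bool" where
  "drazin_invertible a \<longleftrightarrow> (\<exists>x. is_drazin_inverse a x)"

definition drazin_inverse :: "'a::{ring,monoid_mult} \<Rightarrow> 'a" where
  "drazin_inverse a = (THE x. is_drazin_inverse a x)"

definition is_pseudo_core_inverse ::
    "('a::{ring,monoid_mult} \<Rightarrow> 'a) \<Rightarrow> 'a \<Rightarrow> 'a \<Rightarrow> bool" where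
  "is_pseudo_core_inverse star a x \<longleftrightarrow>
     (\<exists>k::nat. k > 0 \<and> x * a ^ (k + 1) = a ^ k) \<and> a * x\<^sup>2 = x \<and> star (a * x) = a * x"

definition pseudo_core_invertible :: "('a::{ring,monoid_mult} \<Rightarrow> 'a) \<Rightarrow> 'a \<Rightarrow> bool" where
  "pseudo_core_invertible star a \<longleftrightarrow> (\<exists>x. is_pseudo_core_inverse star a x)"

definition pseudo_core_inverse :: "('a::{ring,monoid_mult} \<Rightarrow> 'a) \<Rightarrow> 'a \<Rightarrow> 'a" where
  "pseudo_core_inverse star a = (THE x. is_pseudo_core_inverse star a x)"

text \<open>The set \<open>T\<^sub>l(a)\<close>; it is only of interest when \<open>a\<close> is Drazin invertible.\<close>

definition minimal_weak_drazin_inverses :: "'a::{ring,monoid_mult} \<Rightarrow> 'a set" where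
  "minimal_weak_drazin_inverses a =
     {x. (\<exists>k::nat. k > 0 \<and> x * a ^ (k + 1) = a ^ k) \<and> a * x\<^sup>2 = x}"

text \<open>The inverses selected by \<open>THE\<close> above are unique whenever they exist, and
  \<^const>\<open>drazin_inverse\<close> is meaningful for every pseudo core invertible element.\<close>

lemma is_two_sided_inverse_unique:
  assumes "is_two_sided_inverse a x" "is_two_sided_inverse a y"
  shows "x = y"
  using assms unfolding is_two_sided_inverse_def by (metis mult.assoc mult_1_left mult_1_right)

lemma weak_drazin_power_right:
  fixes a x :: "'a::{ring,monoid_mult}"
  assumes "a * x\<^sup>2 = x"
  shows "a ^ n * x ^ (n + 1) = x"
proof (induction n)
  case 0
  show ?case by simp
next
  case (Suc n)
  have "a ^ Suc n * x ^ (Suc n + 1) = a ^ n * ((a * x\<^sup>2) * x ^ n)"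
    by (simp only: power_Suc2 mult.assoc) (simp add: power2_eq_square power_commutes mult.assoc)
  also have "\<dots> = a ^ n * x ^ (n + 1)" by (simp add: assms)
  finally show ?case using Suc by simp
qed

lemma weak_drazin_power_left:
  fixes a x :: "'a::{ring,monoid_mult}"
  assumes "x * a ^ (k + 1) = a ^ k" "k \<le> n"
  shows "x * a ^ (n + 1) = a ^ n"
proof -
  obtain m where n: "n = k + m" using assms(2) le_Suc_ex by blast
  have "x * a ^ (n + 1) = (x * a ^ (k + 1)) * a ^ m"
    unfolding n by (simp add: power_add mult.assoc power_commutes)
  then show ?thesis unfolding assms(1) n by (simp add: power_add)
qed

lemma weak_drazin_mult:
  fixes a x :: "'a::{ring,monoid_mult}"
  assumes x: "a * x\<^sup>2 = x" and y: "y * a ^ (k + 1) = a ^ k"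
  shows "y * a * x = x"
proof -
  have "y * a * x = y * a * (a ^ k * x ^ (k + 1))"
    using weak_drazin_power_right[OF x] by simp
  also have "\<dots> = (y * a ^ (k + 1)) * x ^ (k + 1)" by (simp add: mult.assoc)
  also have "\<dots> = x" unfolding y by (rule weak_drazin_power_right[OF x])
  finally show ?thesis .
qed

lemma is_drazin_inverse_unique:
  assumes "is_drazin_inverse a x" "is_drazin_inverse a y"
  shows "x = y"
proof -
  have "y * a * x = x" "x * a * y = y" "x * a = a * x" "y * a = a * y"
    using assms weak_drazin_mult unfolding is_drazin_inverse_def by blast+
  moreover obtain k l where k: "x * a ^ (k + 1) = a ^ k" and l: "y * a ^ (l + 1) = a ^ l"
    using assms unfolding is_drazin_inverse_def by blast
  moreover define n where "n = max k l"
  ultimately have c: "a ^ n * x = x * a ^ n" "a ^ n * y = y * a ^ n"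
    by (simp_all add: power_commuting_commutes)
  have px: "x * a ^ (n + 1) = a ^ n"
    using weak_drazin_power_left[OF k] by (simp add: n_def)
  have y2: "a * y\<^sup>2 = y" and comm: "x * a = a * x" "y * a = a * y"
    using assms unfolding is_drazin_inverse_def by blast+
  have cc: "a ^ n * y ^ (n + 1) = y ^ (n + 1) * a ^ n"
    by (rule power_commuting_commutes) (metis comm(2) power_commuting_commutes)
  have yn: "y ^ (n + 1) * a ^ n = y"
    using weak_drazin_power_right[OF y2, of n] cc by simp
  have "y = y ^ (n + 1) * (x * a ^ (n + 1))" unfolding px yn ..
  also have "\<dots> = (y ^ (n + 1) * a ^ n) * a * x"
    using c(1) comm(1) by (simp add: mult.assoc power_commutes) (metis mult.assoc power_commutes)
  also have "\<dots> = y * a * x" by (simp only: yn)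
  also have "\<dots> = x" by fact
  finally show ?thesis ..
qed

lemma is_pseudo_core_inverse_unique:
  assumes star: "involution star"
    and "is_pseudo_core_inverse star a x" "is_pseudo_core_inverse star a y"
  shows "x = y"
proof -
  have yx: "y * a * x = x" and xy: "x * a * y = y" and yy: "y * a * y = y"
    using assms weak_drazin_mult unfolding is_pseudo_core_inverse_def by blast+
  have sx: "star (a * x) = a * x" and sy: "star (a * y) = a * y"
    using assms unfolding is_pseudo_core_inverse_def by blast+
  have "a * x = star ((a * y) * (a * x))" using yx sx by (simp add: mult.assoc)
  also have "\<dots> = (a * x) * (a * y)" using star sx sy by (simp add: involution_def)
  also have "\<dots> = a * y" using xy by (simp add: mult.assoc)
  finally show ?thesis using yx yy by (metis mult.assoc)
qed

lemma pseudo_core_invertible_imp_drazin_invertible: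
  assumes "pseudo_core_invertible star a"
  shows "drazin_invertible a"
proof -
  obtain x k where k: "k > 0" and xk: "x * a ^ (k + 1) = a ^ k" and ax: "a * x\<^sup>2 = x"
    using assms unfolding pseudo_core_invertible_def is_pseudo_core_inverse_def by blast
  define d where "d = x ^ (k + 1) * a ^ k"
  obtain m where m: "k = Suc m" using k gr0_implies_Suc by blast
  have "a * x ^ (k + 1) = (a * x\<^sup>2) * x ^ m"
    unfolding m by (simp add: power2_eq_square mult.assoc)
  then have axk: "a * x ^ (k + 1) = x ^ k" unfolding ax m by simp
  have ad: "a * d = x ^ k * a ^ k" unfolding d_def axk[symmetric] by (simp add: mult.assoc)
  have "d * a = x ^ k * (x * a ^ (k + 1))"
    unfolding d_def by (simp only: Suc_eq_plus1[symmetric] power_Suc2 mult.assoc)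
  then have da: "d * a = a * d" unfolding xk ad .
  have "a * d\<^sup>2 = x ^ k * (a ^ k * x ^ (k + 1)) * a ^ k"
    unfolding power2_eq_square mult.assoc[symmetric] ad unfolding d_def by (simp add: mult.assoc)
  also have "\<dots> = d"
    unfolding weak_drazin_power_right[OF ax] d_def by (simp only: Suc_eq_plus1[symmetric] power_Suc2)
  finally have add: "a * d\<^sup>2 = d" .
  have pow: "x ^ j * a ^ (k + j) = a ^ k" for j
  proof (induction j)
    case 0
    show ?case by simp
  next
    case (Suc j)
    have "x ^ Suc j * a ^ (k + Suc j) = x ^ j * (x * a ^ ((k + j) + 1))"
      by (simp only: power_Suc2 mult.assoc add_Suc_right Suc_eq_plus1[symmetric])
    also have "\<dots> = x ^ j * a ^ (k + j)"
      using weak_drazin_power_left[OF xk, of "k + j"] by simp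
    finally show ?case using Suc by simp
  qed
  have "d * a ^ (k + 1) = x ^ (k + 1) * a ^ (k + (k + 1))"
    unfolding d_def by (simp only: power_add mult.assoc)
  then have "d * a ^ (k + 1) = a ^ k" unfolding pow .
  with k add da show ?thesis
    unfolding drazin_invertible_def is_drazin_inverse_def by blast
qed

end

theory Submission
  imports Defs
begin

text \<open>
  Write \<open>T(a)\<close> for the set of minimal weak Drazin inverses of \<open>a\<close>. For \<open>x \<in> T(a)\<close> the element
  \<open>a x\<close> is an idempotent, its right ideal \<open>a x R = x R\<close> does not depend on \<open>x\<close> (it is \<open>a\<^sup>k R\<close> for
  large \<open>k\<close>), and on this ideal, the core of \<open>a\<close>, left multiplication by \<open>a\<close> is a bijection with
  inverse \<open>x\<close>. The choice of \<open>x\<close> amounts to the choice of a complement of the core, that is, of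
  the idempotent \<open>a x\<close>; the pseudo core inverse is the choice for which \<open>a x\<close> is self-adjoint.

  All four statements say that \<open>a\<close> and \<open>f\<close> have the same core. In algebraic form this reads
  \<open>a x = f y\<close> for some \<open>x \<in> T(a)\<close> and \<open>y \<in> T(f)\<close>. If it holds, then every \<open>x' \<in> T(a)\<close> has a partner
  in \<open>T(f)\<close>, namely \<open>y a x'\<close>, with \<open>f (y a x') = a x'\<close> (lemma \<open>partner_in_T\<close>). A self-adjoint
  \<open>a x'\<close> makes the partner the pseudo core inverse of \<open>f\<close>, by uniqueness, so the condition is
  equivalent to the single equation \<open>a a\<^sup>(\<^sup>D\<^sup>) = f f\<^sup>(\<^sup>D\<^sup>)\<close>.

  For partners \<open>x\<close> and \<open>y\<close>, computing with \<open>b = f - a\<close> on the common core gives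
  \<open>x b y = x - y = y b x\<close>. These two identities make \<open>1 - y b\<close> the inverse of \<open>1 + x b\<close>, and they
  turn \<open>(1 + x b)\<^sup>-\<^sup>1 x\<close> into \<open>y\<close>. Conversely, \<open>y = (1 + x b)\<^sup>-\<^sup>1 x\<close> implies \<open>x = y + x b y\<close>, which
  already forces \<open>a x = f y\<close> (lemma \<open>common_projection_if_perturbed\<close>). The second, third and
  fourth statement are instances of this for different choices of \<open>x\<close>, and the first one is a
  rearrangement of \<open>x = y + x b y\<close> for the two pseudo core inverses.
\<close>

lemma T_square:
  assumes "x \<in> minimal_weak_drazin_inverses a"
  shows "a * x * x = x"
  using assms by (simp add: minimal_weak_drazin_inverses_def power2_eq_square mult.assoc)

text \<open>The elements of \<open>T(a)\<close> are right multiples of powers of \<open>a\<close>, and \<open>x a\<close> fixes high powers.\<close>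

lemma T_absorb:
  assumes "x \<in> minimal_weak_drazin_inverses a" "x' \<in> minimal_weak_drazin_inverses a"
  shows "x * a * x' = x'"
  using assms weak_drazin_mult unfolding minimal_weak_drazin_inverses_def by blast

lemma T_absorb_projection:
  assumes x: "x \<in> minimal_weak_drazin_inverses a" and x': "x' \<in> minimal_weak_drazin_inverses a"
  shows "x * a * (a * x') = a * x'"
proof -
  obtain k where k: "x * a ^ (k + 1) = a ^ k"
    using x unfolding minimal_weak_drazin_inverses_def by blast
  have "a * x'\<^sup>2 = x'" using x' unfolding minimal_weak_drazin_inverses_def by blast
  then have x'_eq: "x' = a ^ k * x' ^ (k + 1)" by (rule weak_drazin_power_right[symmetric])
  have ax': "a * x' = a ^ (k + 1) * x' ^ (k + 1)"
    by (subst x'_eq) (simp add: mult.assoc)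
  have "x * a * (a * x') = x * a ^ ((k + 1) + 1) * x' ^ (k + 1)"
    unfolding ax' by (simp add: mult.assoc)
  also have "x * a ^ ((k + 1) + 1) = a ^ (k + 1)"
    using k by (rule weak_drazin_power_left) simp
  finally show ?thesis using ax' by simp
qed

lemma T_projection_absorb:
  assumes x: "x \<in> minimal_weak_drazin_inverses a" and x': "x' \<in> minimal_weak_drazin_inverses a"
  shows "a * x * x' = x'"
proof -
  have "a * x * x' = a * x * (x * a * x')" by (simp only: T_absorb[OF x x'])
  also have "\<dots> = (a * x * x) * a * x'" by (simp only: mult.assoc)
  also have "\<dots> = x'" by (simp only: T_square[OF x] T_absorb[OF x x'])
  finally show ?thesis .
qed

text \<open>
  If \<open>a\<close> and \<open>f\<close> have the same core, then \<open>y\<close> inverts \<open>f\<close> on every element of \<open>T(a)\<close>, since that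
  element lies in the core of \<open>f\<close>.
\<close>

lemma common_projection_absorb:
  assumes x: "x \<in> minimal_weak_drazin_inverses a" and y: "y \<in> minimal_weak_drazin_inverses f"
    and eq: "a * x = f * y" and x': "x' \<in> minimal_weak_drazin_inverses a"
  shows "y * f * x' = x'"
proof -
  have x'_eq: "f * y * x' = x'" using T_projection_absorb[OF x x'] eq by simp
  have "y * f * x' = (y * f * (f * y)) * x'" by (subst x'_eq[symmetric]) (simp only: mult.assoc)
  then show ?thesis by (simp only: T_absorb_projection[OF y y] x'_eq)
qed

text \<open>
  The elements of \<open>T(f)\<close> correspond to the idempotents that project onto the core of \<open>f\<close>. Since
  \<open>a x'\<close> projects onto the same core, it belongs to exactly one element of \<open>T(f)\<close>, which is
  obtained by inverting \<open>f\<close> on the image of \<open>a x'\<close>.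
\<close>

lemma partner_in_T:
  assumes x: "x \<in> minimal_weak_drazin_inverses a" and y: "y \<in> minimal_weak_drazin_inverses f"
    and eq: "a * x = f * y" and x': "x' \<in> minimal_weak_drazin_inverses a"
  shows "y * a * x' \<in> minimal_weak_drazin_inverses f" and "f * (y * a * x') = a * x'"
proof -
  have "f * (y * a * x') = (a * x) * (a * x')" by (simp only: eq mult.assoc)
  also have "\<dots> = a * (x * a * x')" by (simp only: mult.assoc)
  finally show proj: "f * (y * a * x') = a * x'" by (simp only: T_absorb[OF x x'])
  have y_eq: "a * x * y = y" using T_square[OF y] eq by simp
  \<comment> \<open>\<open>a x'\<close> is the identity on the common core, which contains \<open>y\<close>.\<close>
  have "a * x' * y = a * (x' * a * x) * y" by (subst y_eq[symmetric]) (simp only: mult.assoc)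
  then have fix_y: "a * x' * y = y" by (simp only: T_absorb[OF x' x] y_eq)
  have "f * (y * a * x')\<^sup>2 = (f * (y * a * x')) * (y * a * x')"
    by (simp only: power2_eq_square mult.assoc)
  also have "\<dots> = (a * x' * y) * a * x'" unfolding proj by (simp only: mult.assoc)
  finally have square: "f * (y * a * x')\<^sup>2 = y * a * x'" by (simp only: fix_y)
  obtain k where "k > 0" and k: "y * f ^ (k + 1) = f ^ k"
    using y unfolding minimal_weak_drazin_inverses_def by blast
  have k1: "y * f ^ ((k + 1) + 1) = f ^ (k + 1)"
    using k by (rule weak_drazin_power_left) simp
  have "y * a * x' * f ^ (k + 1) = y * (a * x' * y) * f ^ ((k + 1) + 1)"
    by (subst k1[symmetric]) (simp only: mult.assoc)
  also have "\<dots> = f ^ k" unfolding fix_y unfolding mult.assoc k1 by (fact k)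
  finally show "y * a * x' \<in> minimal_weak_drazin_inverses f"
    using \<open>k > 0\<close> square unfolding minimal_weak_drazin_inverses_def by blast
qed

text \<open>
  With \<open>b = f - a\<close>, the product \<open>x b y\<close> is \<open>x (f y) - (x a) y = x a x - y = x - y\<close>, because \<open>x a\<close> is
  the identity on the common core. The situation is symmetric in the two pairs \<open>(a, x)\<close> and
  \<open>(f, y)\<close>, up to the sign of \<open>b\<close>, which gives \<open>y b x = x - y\<close> as well.
\<close>

lemma common_projection_difference:
  assumes x: "x \<in> minimal_weak_drazin_inverses a" and y: "y \<in> minimal_weak_drazin_inverses f"
    and eq: "a * x = f * y" and f: "f = a + b"
  shows "x * b * y = x - y" and "y * b * x = x - y"
proof -
  have b: "b = f - a" using f by simp
  have "x * f * y = x * a * x" and "y * a * x = y * f * y" using eq by (simp_all only: mult.assoc)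
  then have xfy: "x * f * y = x" and yax: "y * a * x = y"
    by (simp_all only: T_absorb[OF x x] T_absorb[OF y y])
  have xay: "x * a * y = y" by (rule common_projection_absorb[OF y x eq[symmetric] y])
  have yfx: "y * f * x = x" by (rule common_projection_absorb[OF x y eq x])
  show "x * b * y = x - y" unfolding b by (simp only: right_diff_distrib left_diff_distrib xfy xay)
  show "y * b * x = x - y" unfolding b by (simp only: right_diff_distrib left_diff_distrib yfx yax)
qed

lemma ring_inverse_eqI:
  assumes "is_two_sided_inverse u v"
  shows "ring_invertible u" and "ring_inverse u = v"
proof -
  show "ring_invertible u" using assms unfolding ring_invertible_def by blast
  show "ring_inverse u = v" unfolding ring_inverse_def
    using assms by (rule the_equality) (rule is_two_sided_inverse_unique[OF _ assms])
qed

lemma ring_inverse_cancel: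
  assumes "ring_invertible u"
  shows "u * (ring_inverse u * w) = w"
proof -
  obtain v where v: "is_two_sided_inverse u v" using assms unfolding ring_invertible_def by blast
  then have "ring_inverse u = v" by (rule ring_inverse_eqI)
  moreover have "u * (v * w) = (u * v) * w" by (simp only: mult.assoc)
  ultimately show ?thesis using v unfolding is_two_sided_inverse_def by simp
qed

lemma common_projection_inverse:
  assumes x: "x \<in> minimal_weak_drazin_inverses a" and y: "y \<in> minimal_weak_drazin_inverses f"
    and eq: "a * x = f * y" and f: "f = a + b"
  shows "is_two_sided_inverse (1 + x * b) (1 - y * b)"
proof -
  note diff = common_projection_difference[OF x y eq f]
  have "(1 + x * b) * (1 - y * b) = 1 + (x - y) * b - (x * b * y) * b"
    by (simp add: algebra_simps)
  moreover have "(1 - y * b) * (1 + x * b) = 1 + (x - y) * b - (y * b * x) * b"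
    by (simp add: algebra_simps)
  ultimately show ?thesis unfolding is_two_sided_inverse_def diff by simp
qed

lemma common_projection_inverse_mult:
  assumes x: "x \<in> minimal_weak_drazin_inverses a" and y: "y \<in> minimal_weak_drazin_inverses f"
    and eq: "a * x = f * y" and f: "f = a + b" and x': "x' \<in> minimal_weak_drazin_inverses a"
  shows "ring_invertible (1 + x * b)" and "ring_inverse (1 + x * b) * x' = y * a * x'"
proof -
  note inv = ring_inverse_eqI[OF common_projection_inverse[OF x y eq f]]
  show "ring_invertible (1 + x * b)" by (rule inv)
  have "(1 - y * b) * x' = x' - y * f * x' + y * a * x'" unfolding f by (simp add: algebra_simps)
  then show "ring_inverse (1 + x * b) * x' = y * a * x'"
    using common_projection_absorb[OF x y eq x'] inv(2) by simp
qed

text \<open>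
  The hypothesis \<open>x = y + x b y\<close> puts \<open>y\<close>, and with it the core of \<open>f\<close>, into the core of \<open>a\<close>. Then
  \<open>x f y = x a y + x b y = x\<close>, so that \<open>a x = (a x) (f y)\<close>; here the factor \<open>a x\<close> may be dropped,
  because \<open>f y\<close> already lies in the core of \<open>a\<close>.
\<close>

lemma common_projection_if_perturbed:
  assumes x: "x \<in> minimal_weak_drazin_inverses a" and y: "y \<in> minimal_weak_drazin_inverses f"
    and f: "f = a + b" and pert: "(1 + x * b) * y = x"
  shows "a * x = f * y"
proof -
  have xby: "x * b * y = x - y" using pert by (simp add: algebra_simps)
  then have y_eq: "y = x - x * b * y" by simp
  have "x * a * y = x * a * x - (x * a * x) * b * y"
    by (subst y_eq) (simp only: right_diff_distrib mult.assoc)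
  then have xay: "x * a * y = y" using xby by (simp only: T_absorb[OF x x]) simp
  have "x * f * y = x * a * y + x * b * y" unfolding f by (simp only: distrib_left distrib_right)
  then have xfy: "x * f * y = x" using xay xby by simp
  have "a * x * y = (a * x * x) * a * y" using xay by (simp only: mult.assoc)
  then have axy: "a * x * y = y" by (simp only: T_square[OF x] xay)
  have fy: "y * f * (f * y) = f * y" by (rule T_absorb_projection[OF y y])
  have "a * x = a * x * (f * y)" using xfy by (simp only: mult.assoc)
  also have "\<dots> = (a * x * y) * f * (f * y)" by (subst fy[symmetric]) (simp only: mult.assoc)
  also have "\<dots> = f * y" by (simp only: axy fy)
  finally show ?thesis .
qed

lemma is_pseudo_core_inverse_iff:
  "is_pseudo_core_inverse star a p \<longleftrightarrow>
     p \<in> minimal_weak_drazin_inverses a \<and> star (a * p) = a * p"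
  unfolding is_pseudo_core_inverse_def minimal_weak_drazin_inverses_def by blast

lemma pseudo_core_inverse_is_pseudo_core_inverse:
  assumes "involution star" "pseudo_core_invertible star a"
  shows "is_pseudo_core_inverse star a (pseudo_core_inverse star a)"
proof -
  obtain p where p: "is_pseudo_core_inverse star a p"
    using assms(2) unfolding pseudo_core_invertible_def by blast
  then show ?thesis unfolding pseudo_core_inverse_def
    by (rule theI) (rule is_pseudo_core_inverse_unique[OF assms(1) _ p])
qed

lemma drazin_inverse_in_T:
  assumes "drazin_invertible a"
  shows "drazin_inverse a \<in> minimal_weak_drazin_inverses a"
proof -
  obtain d where d: "is_drazin_inverse a d" using assms unfolding drazin_invertible_def by blast
  then have "drazin_inverse a = d" unfolding drazin_inverse_def
    by (rule the_equality) (rule is_drazin_inverse_unique[OF _ d])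
  with d show ?thesis
    unfolding is_drazin_inverse_def minimal_weak_drazin_inverses_def by blast
qed

text \<open>
  The partner of the pseudo core inverse of \<open>a\<close> has the same, self-adjoint, idempotent. So it is
  the pseudo core inverse of \<open>f\<close>.
\<close>

lemma common_projection_pseudo_core:
  assumes star: "involution star"
    and p: "is_pseudo_core_inverse star a p" and q: "is_pseudo_core_inverse star f q"
    and x: "x \<in> minimal_weak_drazin_inverses a" and y: "y \<in> minimal_weak_drazin_inverses f"
    and eq: "a * x = f * y"
  shows "a * p = f * q"
proof -
  have pT: "p \<in> minimal_weak_drazin_inverses a" and sp: "star (a * p) = a * p"
    using p unfolding is_pseudo_core_inverse_iff by blast+
  note partner = partner_in_T[OF x y eq pT]
  have "is_pseudo_core_inverse star f (y * a * p)"
    unfolding is_pseudo_core_inverse_iff partner(2) using partner(1) sp by blast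
  then have "y * a * p = q" by (rule is_pseudo_core_inverse_unique[OF star _ q])
  with partner(2) show ?thesis by simp
qed

text \<open>
  Since \<open>p a p = p\<close>, left multiplication by \<open>p a\<close> fixes the left side of the sum formula. It thus
  fixes \<open>p + q\<close>, so that \<open>p a q = q\<close>. With \<open>a + f = 2 a + b\<close>, the formula becomes \<open>q + p b q = p\<close>.
\<close>

lemma sum_formula_iff_common_projection:
  assumes p: "p \<in> minimal_weak_drazin_inverses a" and q: "q \<in> minimal_weak_drazin_inverses f"
    and f: "f = a + b"
  shows "p * (a + f) * q = p + q \<longleftrightarrow> a * p = f * q"
proof
  assume sum: "p * (a + f) * q = p + q"
  have "p * a * (p * (a + f) * q) = (p * a * p) * (a + f) * q" by (simp only: mult.assoc)
  then have "p * a * (p + q) = p + q" by (simp only: T_absorb[OF p p] sum)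
  then have paq: "p * a * q = q" by (simp only: distrib_left T_absorb[OF p p] add_left_cancel)
  have "p * (a + f) * q = p * a * q + (p * a * q + p * b * q)"
    unfolding f by (simp only: distrib_left distrib_right)
  then have "q + (q + p * b * q) = p + q" unfolding paq sum by simp
  then have "q + p * b * q = p" by (simp add: add.commute[of p])
  then have "(1 + p * b) * q = p" by (simp add: distrib_right)
  with p q f show "a * p = f * q" by (rule common_projection_if_perturbed)
next
  assume eq: "a * p = f * q"
  have "p * (a + f) * q = p * a * q + p * (f * q)"
    by (simp only: distrib_left distrib_right mult.assoc)
  also have "p * (f * q) = p * a * p" by (simp only: eq[symmetric] mult.assoc)
  also have "p * a * q = q" by (rule common_projection_absorb[OF q p eq[symmetric] q])
  finally show "p * (a + f) * q = p + q" by (simp only: T_absorb[OF p p] add.commute)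
qed

theorem theorem4p7:
  fixes star :: "'a::{ring,monoid_mult} \<Rightarrow> 'a" and a b f :: 'a
  assumes "involution star"
    and "pseudo_core_invertible star a"
    and "f = a + b"
    and "pseudo_core_invertible star f"
  defines "S1 \<equiv> pseudo_core_inverse star a * (a + f) * pseudo_core_inverse star f
                  = pseudo_core_inverse star a + pseudo_core_inverse star f"
    and "S2 \<equiv> ring_invertible (1 + pseudo_core_inverse star a * b) \<and>
              pseudo_core_inverse star f
                = ring_inverse (1 + pseudo_core_inverse star a * b) * pseudo_core_inverse star a"
    and "S3 \<equiv> ring_invertible (1 + drazin_inverse a * b) \<and>
              ring_inverse (1 + drazin_inverse a * b) * drazin_inverse a
                \<in> minimal_weak_drazin_inverses f"
    and "S4 \<equiv> ring_invertible (1 + pseudo_core_inverse star a * b) \<and>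
              (\<forall>x \<in> minimal_weak_drazin_inverses a.
                 ring_inverse (1 + pseudo_core_inverse star a * b) * x
                   \<in> minimal_weak_drazin_inverses f)"
  shows "(S1 \<longleftrightarrow> S2) \<and> (S1 \<longleftrightarrow> S3) \<and> (S1 \<longleftrightarrow> S4)"
proof -
  let ?p = "pseudo_core_inverse star a" and ?q = "pseudo_core_inverse star f"
  let ?d = "drazin_inverse a"
  note f = \<open>f = a + b\<close>
  have pc: "is_pseudo_core_inverse star a ?p" and qc: "is_pseudo_core_inverse star f ?q"
    using assms(1,2,4) by (simp_all only: pseudo_core_inverse_is_pseudo_core_inverse)
  then have p: "?p \<in> minimal_weak_drazin_inverses a" and q: "?q \<in> minimal_weak_drazin_inverses f"
    unfolding is_pseudo_core_inverse_iff by blast+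
  have d: "?d \<in> minimal_weak_drazin_inverses a"
    using assms(2) by (intro drazin_inverse_in_T pseudo_core_invertible_imp_drazin_invertible)
  have common: "a * ?p = f * ?q"
    if x: "x \<in> minimal_weak_drazin_inverses a" and inv: "ring_invertible (1 + x * b)"
      and y: "ring_inverse (1 + x * b) * x \<in> minimal_weak_drazin_inverses f" for x
    by (rule common_projection_pseudo_core[OF assms(1) pc qc x y
          common_projection_if_perturbed[OF x y f ring_inverse_cancel[OF inv]]])
  have S1: "S1 \<longleftrightarrow> a * ?p = f * ?q"
    unfolding S1_def by (rule sum_formula_iff_common_projection[OF p q f])
  have S2: "S2 \<longleftrightarrow> a * ?p = f * ?q"
  proof
    assume S2
    then show "a * ?p = f * ?q" using common[OF p] q unfolding S2_def by simp
  next
    assume eq: "a * ?p = f * ?q"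
    have "?q * a * ?p = ?q * f * ?q" using eq by (simp only: mult.assoc)
    then have "?q * a * ?p = ?q" by (simp only: T_absorb[OF q q])
    then show S2 using common_projection_inverse_mult[OF p q eq f p] unfolding S2_def by simp
  qed
  have S3: "S3 \<longleftrightarrow> a * ?p = f * ?q"
  proof
    assume S3
    then show "a * ?p = f * ?q" using common[OF d] unfolding S3_def by blast
  next
    assume eq: "a * ?p = f * ?q"
    \<comment> \<open>the partner of the Drazin inverse\<close>
    define z where "z = ?q * a * ?d"
    have z: "z \<in> minimal_weak_drazin_inverses f" and dz: "a * ?d = f * z"
      using partner_in_T[OF p q eq d] by (simp_all add: z_def)
    show S3 unfolding S3_def common_projection_inverse_mult(2)[OF d z dz f d]
      using common_projection_inverse_mult(1)[OF d z dz f d] partner_in_T(1)[OF d z dz d] by blast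
  qed
  have S4: "S4 \<longleftrightarrow> a * ?p = f * ?q"
  proof
    assume S4
    then show "a * ?p = f * ?q" using common[OF p] p unfolding S4_def by blast
  next
    assume eq: "a * ?p = f * ?q"
    show S4 unfolding S4_def
      using common_projection_inverse_mult[OF p q eq f] partner_in_T(1)[OF p q eq] p by simp
  qed
  show ?thesis using S1 S2 S3 S4 by blast
qed

end
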